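(* Let $k\ge 1$, $h\ge 1$ and $n$ be integers with $0\le n<h$, let $c_{-k},\dots,c_h\in\mathbb{C}$ with $c_h\neq 0$, set $c_i=0$ for $i<-k$ and $i>h$, and let $\mathcal{A}=(c_{j-i})_{i,j=1,2,\dots}$ be the associated infinite banded Toeplitz matrix ($i$ is the row index, $j$ the column index). Let $B_{\mathcal{A}}\subset\mathbb{C}^{n+1}$ be the limit set of eigenvalue loci of $\mathcal{A}$ and let $C_{\mathcal{A}}\subset\mathbb{C}^{n+1}$ be the real semi-algebraic set $$C_{\mathcal{A}}=\{\mathbf{x}\in\mathbb{C}^{n+1} : |\alpha_k(\mathbf{x})|=|\alpha_{k+1}(\mathbf{x})|=\dots=|\alpha_{k+n+1}(\mathbf{x})|\},$$ both as defined in the context. Then $B_{\mathcal{A}}\subseteq C_{\mathcal{A}}$.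
   Context: Write $\mathbf{x}=(x_0,\dots,x_n)\in\mathbb{C}^{n+1}$. For integers $m>0$, $n\ge 0$ and $s=0,\dots,n$, let $\mathcal{I}_s$ be the $m\times(m+n)$ matrix whose $(i,j)$ entry is $1$ if $j=i+s$ and $0$ otherwise. For a complex $m\times(m+n)$ matrix $A$ its eigenvalue locus is $$\mathcal{E}_A=\Big\{\mathbf{x}\in\mathbb{C}^{n+1} : \operatorname{rank}\Big(A-\sum_{s=0}^n x_s\mathcal{I}_s\Big)<m\Big\}.$$ For an infinite matrix $\mathcal{A}$ let $\mathcal{E}^{(m)}_{\mathcal{A}}$ be the eigenvalue locus of the $m\times(m+n)$ submatrix of $\mathcal{A}$ formed by its first $m$ rows and first $m+n$ columns. The limit set of eigenvalue loci is $$B_{\mathcal{A}}=\Big\{\mathbf{x}\in\mathbb{C}^{n+1} : \mathbf{x}=\lim_{m\to\infty}\mathbf{x}_m \text{ for some sequence with } \mathbf{x}_m\in\mathcal{E}^{(m)}_{\mathcal{A}} \text{ for every } m\Big\}.$$ Set $$Q(t,\mathbf{x})=t^k\Big(\sum_{j=-k}^h c_jt^j-\sum_{j=0}^n x_jt^j\Big),$$ a polynomial in $t$ of degree $k+h$, and let $\alpha_1(\mathbf{x}),\dots,\alpha_{k+h}(\mathbf{x})$ be its roots in $t$ (with multiplicity), ordered so that $|\alpha_i(\mathbf{x})|\le|\alpha_{i+1}(\mathbf{x})|$ for $0<i<k+h$. *)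

theory Defs
  imports
    Complex_Main
    "HOL-Computational_Algebra.Computational_Algebra"
    "Jordan_Normal_Form.DL_Rank"
begin

text \<open>
  Points of \<open>\<complex>\<^sup>n\<^sup>+\<^sup>1\<close> are vectors in \<open>carrier_vec (n + 1)\<close>, with entries indexed by \<open>0, \<dots>, n\<close>.
  Finite matrices are indexed from 0. Infinite matrices are functions of a row and a
  column index, both ranging over \<open>1, 2, \<dots>\<close>; their value at index 0 is never used.
\<close>

definition shifted_identity :: "nat \<Rightarrow> nat \<Rightarrow> nat \<Rightarrow> complex mat" where
  "shifted_identity m n s = mat m (m + n) (\<lambda>(i, j). if j = i + s then 1 else 0)"

text \<open>
  The type of matrices is not an additive monoid (the dimensions vary), so the matrix
  \<open>\<Sum>s\<le>n. x\<^sub>s I\<^sub>s\<close> is formed entrywise.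
\<close>

definition shift_combination :: "nat \<Rightarrow> nat \<Rightarrow> complex vec \<Rightarrow> complex mat" where
  "shift_combination m n x =
     mat m (m + n) (\<lambda>(i, j). \<Sum>s\<le>n. (x $ s) * (shifted_identity m n s $$ (i, j)))"

definition eigenvalue_locus :: "nat \<Rightarrow> nat \<Rightarrow> complex mat \<Rightarrow> complex vec set" where
  "eigenvalue_locus m n A =
     {x \<in> carrier_vec (n + 1). vec_space.rank m (A - shift_combination m n x) < m}"

definition leading_submatrix :: "nat \<Rightarrow> nat \<Rightarrow> (nat \<Rightarrow> nat \<Rightarrow> complex) \<Rightarrow> complex mat" where
  "leading_submatrix m n A = mat m (m + n) (\<lambda>(i, j). A (i + 1) (j + 1))"

definition vec_tendsto :: "nat \<Rightarrow> (nat \<Rightarrow> complex vec) \<Rightarrow> complex vec \<Rightarrow> bool" where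
  "vec_tendsto d X x \<longleftrightarrow> (\<forall>i<d. (\<lambda>m. X m $ i) \<longlonglongrightarrow> x $ i)"

text \<open>Sequences are indexed by \<open>m > 0\<close>; the value at \<open>m = 0\<close> is unconstrained.\<close>

definition limit_set :: "nat \<Rightarrow> (nat \<Rightarrow> nat \<Rightarrow> complex) \<Rightarrow> complex vec set" where
  "limit_set n A =
     {x \<in> carrier_vec (n + 1).
        \<exists>X. (\<forall>m>0. X m \<in> eigenvalue_locus m n (leading_submatrix m n A)) \<and>
            vec_tendsto (n + 1) X x}"

definition toeplitz :: "(int \<Rightarrow> complex) \<Rightarrow> nat \<Rightarrow> nat \<Rightarrow> complex" where
  "toeplitz c i j = c (int j - int i)"

text \<open>The factor \<open>t\<^sup>k\<close> is multiplied into the Laurent polynomial; see \<open>poly_symbol_poly\<close>.\<close>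

definition symbol_poly :: "nat \<Rightarrow> nat \<Rightarrow> nat \<Rightarrow> (int \<Rightarrow> complex) \<Rightarrow> complex vec \<Rightarrow> complex poly" where
  "symbol_poly k h n c x =
     (\<Sum>j\<in>{- int k..int h}. monom (c j) (nat (int k + j))) - (\<Sum>j\<le>n. monom (x $ j) (k + j))"

definition ordered_roots :: "complex poly \<Rightarrow> (nat \<Rightarrow> complex) \<Rightarrow> bool" where
  "ordered_roots p \<alpha> \<longleftrightarrow>
     image_mset \<alpha> (mset_set {1..degree p}) = proots p \<and>
     (\<forall>i. 0 < i \<and> i < degree p \<longrightarrow> cmod (\<alpha> i) \<le> cmod (\<alpha> (i + 1)))"

text \<open>
  The ordering \<open>\<alpha>\<close> of the roots exists but need not be unique; the moduli \<open>\<bar>\<alpha>\<^sub>i\<bar>\<close> are unique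
  (\<open>ordered_roots_exists\<close>, \<open>ordered_roots_cmod_unique\<close>), so the choice of \<open>\<alpha>\<close> is immaterial.
\<close>

definition equimodular_set :: "nat \<Rightarrow> nat \<Rightarrow> nat \<Rightarrow> (int \<Rightarrow> complex) \<Rightarrow> complex vec set" where
  "equimodular_set k h n c =
     {x \<in> carrier_vec (n + 1).
        \<exists>\<alpha>. ordered_roots (symbol_poly k h n c x) \<alpha> \<and>
            (\<forall>i\<in>{k..k + n}. cmod (\<alpha> i) = cmod (\<alpha> (i + 1)))}"

lemma poly_symbol_poly:
  assumes "t \<noteq> 0"
  shows "poly (symbol_poly k h n c x) t =
    t ^ k * ((\<Sum>j\<in>{- int k..int h}. c j * t powi j) - (\<Sum>j\<le>n. x $ j * t ^ j))"
proof -
  have "t ^ nat (int k + j) = t ^ k * t powi j" if "j \<in> {- int k..int h}" for j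
  proof -
    have "t ^ nat (int k + j) = t powi (int k + j)"
      using that by (simp add: power_int_def)
    then show ?thesis using assms by (simp add: power_int_add)
  qed
  then show ?thesis
    by (simp add: symbol_poly_def poly_sum poly_monom right_diff_distrib sum_distrib_left
        power_add mult_ac)
qed

lemma degree_symbol_poly:
  assumes "n < h" "c (int h) \<noteq> 0"
  shows "degree (symbol_poly k h n c x) = k + h"
proof (rule antisym)
  show "degree (symbol_poly k h n c x) \<le> k + h"
    unfolding symbol_poly_def using assms
    by (intro degree_diff_le degree_sum_le) (auto intro: order_trans[OF degree_monom_le])
next
  have "coeff (symbol_poly k h n c x) (k + h) =
      (\<Sum>j\<in>{- int k..int h}. if j = int h then c j else 0)
      - (\<Sum>j\<le>n. if k + j = k + h then x $ j else 0)"
    unfolding symbol_poly_def coeff_diff coeff_sum coeff_monom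
    by (intro arg_cong2[where f = minus] sum.cong) auto
  also have "\<dots> = c (int h)"
    using assms by (auto simp: sum.delta)
  finally show "k + h \<le> degree (symbol_poly k h n c x)"
    using assms by (intro le_degree) simp
qed

lemma ordered_roots_exists: "\<exists>\<alpha>. ordered_roots p \<alpha>"
proof -
  obtain xs where xs: "mset xs = proots p" using ex_mset by blast
  define ys where "ys = sort_key cmod xs"
  have len: "length ys = degree p"
    by (metis xs size_mset size_proots_complex ys_def length_sort)
  have "image_mset (\<lambda>i. ys ! (i - 1)) (mset_set {1..degree p}) =
      mset (map (\<lambda>i. ys ! (i - 1)) [1..<Suc (degree p)])"
    by (simp only: mset_map mset_upt atLeastLessThanSuc_atLeastAtMost)
  also have "map (\<lambda>i. ys ! (i - 1)) [1..<Suc (degree p)] = ys"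
    using len by (intro nth_equalityI) (auto simp del: upt_Suc)
  finally have "image_mset (\<lambda>i. ys ! (i - 1)) (mset_set {1..degree p}) = proots p"
    using xs by (simp add: ys_def)
  moreover have "sorted (map cmod ys)" by (simp add: ys_def)
  then have "cmod (ys ! (i - 1)) \<le> cmod (ys ! (i + 1 - 1))" if "0 < i" "i < degree p" for i
    using that len sorted_nth_mono[of "map cmod ys" "i - 1" i] by simp
  ultimately show ?thesis unfolding ordered_roots_def by blast
qed

lemma ordered_roots_cmod_unique:
  assumes "ordered_roots p \<alpha>" "ordered_roots p \<beta>" "i \<in> {1..degree p}"
  shows "cmod (\<alpha> i) = cmod (\<beta> i)"
proof -
  define L where "L = (\<lambda>\<gamma>. map (\<lambda>i. cmod (\<gamma> i)) [1..<Suc (degree p)])"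
  have *: "mset (L \<gamma>) = image_mset cmod (proots p) \<and> sorted (L \<gamma>)"
    if "ordered_roots p \<gamma>" for \<gamma> :: "nat \<Rightarrow> complex"
  proof
    have "mset (L \<gamma>) = image_mset cmod (image_mset \<gamma> (mset_set {1..degree p}))"
      by (simp only: L_def mset_map mset_upt atLeastLessThanSuc_atLeastAtMost
          multiset.map_comp o_def)
    then show "mset (L \<gamma>) = image_mset cmod (proots p)"
      using that by (simp add: ordered_roots_def)
    show "sorted (L \<gamma>)"
      unfolding sorted_iff_nth_Suc L_def
      using that by (auto simp: ordered_roots_def simp del: upt_Suc)
  qed
  have "L \<alpha> = L \<beta>"
    using *[OF assms(1)] *[OF assms(2)] properties_for_sort by metis
  then have "L \<alpha> ! (i - 1) = L \<beta> ! (i - 1)" by simp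
  then show ?thesis using assms(3) by (auto simp: L_def simp del: upt_Suc)
qed

end

theory Submission
  imports Defs "Jordan_Normal_Form.DL_Rank_Submatrix"
begin

text \<open>
  Suppose \<open>\<bar>\<alpha>\<^sub>j\<bar> < \<bar>\<alpha>\<^sub>j\<^sub>+\<^sub>1\<bar>\<close> for some \<open>k \<le> j \<le> k + n\<close>. By continuity of the roots, along a subsequence
  the symbol polynomials \<open>Q\<close> at \<open>x\<^sub>m\<close> have \<open>j\<close> roots in a disc and the remaining ones outside a larger
  disc. The \<open>m\<close> consecutive columns starting at column \<open>j - k\<close> form a singular square Toeplitz matrix;
  a vector in its left kernel is a polynomial \<open>Y \<noteq> 0\<close> of degree less than \<open>m\<close> such that \<open>F = Q Y\<close>
  has vanishing coefficients at all indices in \<open>[j, j + m)\<close>. Dividing \<open>F\<close> by the factors of the large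
  roots bounds the coefficients above the gap by those below it, and dividing the reflected
  polynomial by the factors of the small roots bounds those below by those above. As the two discs
  have different radii, the two bounds gain a factor that decays exponentially in \<open>m\<close>, so \<open>F = 0\<close>
  for large \<open>m\<close>.
\<close>

section \<open>Polynomials with a gap in their coefficients\<close>

text \<open>A weighted l1 norm of the truncation to indices below \<open>n\<close>. Coefficients of
  a product below \<open>n\<close> depend only on coefficients of the factors below
  \<open>n\<close>, so multiplication estimates survive truncation and can be read off on one side
  of a gap.\<close>

definition wnorm :: "real \<Rightarrow> nat \<Rightarrow> 'a::real_normed_field poly \<Rightarrow> real" where
  "wnorm w n p = (\<Sum>i<n. norm (coeff p i) * w ^ i)"

lemma wnorm_0 [simp]: "wnorm w 0 p = 0"
  by (simp add: wnorm_def)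

lemma wnorm_Suc: "wnorm w (Suc n) p = wnorm w n p + norm (coeff p n) * w ^ n"
  by (simp add: wnorm_def)

lemma wnorm_nonneg: "0 \<le> w \<Longrightarrow> 0 \<le> wnorm w n p"
  by (auto simp: wnorm_def intro!: sum_nonneg)

lemma wnorm_mono: "0 \<le> w \<Longrightarrow> m \<le> n \<Longrightarrow> wnorm w m p \<le> wnorm w n p"
  unfolding wnorm_def by (intro sum_mono2) auto

lemma wnorm_eqI:
  assumes "m \<le> n" "\<And>i. m \<le> i \<Longrightarrow> i < n \<Longrightarrow> coeff p i = 0"
  shows "wnorm w n p = wnorm w m p"
  unfolding wnorm_def using assms by (intro sum.mono_neutral_right) auto

text \<open>Multiplication by \<open>[:1, -\<gamma>:]\<close> perturbs the coefficient at
  \<open>i + 1\<close> by \<open>\<gamma>\<close> times the coefficient at \<open>i\<close>; the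
  shift by one index costs one factor \<open>w\<close>. The triangle inequality then gives both
  bounds.\<close>

lemma wnorm_linear_mult:
  fixes p :: "'a::real_normed_field poly"
  assumes "0 \<le> w" "norm \<gamma> \<le> \<rho>"
  shows "(1 - \<rho> * w) * wnorm w n p \<le> wnorm w n ([:1, -\<gamma>:] * p)"
    and "wnorm w n ([:1, -\<gamma>:] * p) \<le> (1 + \<rho> * w) * wnorm w n p"
proof -
  have \<rho>: "0 \<le> \<rho>" using assms(2) norm_ge_zero order_trans by blast
  have step: "\<bar>norm (coeff ([:1, -\<gamma>:] * p) (Suc i)) * w ^ Suc i - norm (coeff p (Suc i)) * w ^ Suc i\<bar>
      \<le> \<rho> * w * (norm (coeff p i) * w ^ i)" for i
  proof -
    have "coeff ([:1, -\<gamma>:] * p) (Suc i) = coeff p (Suc i) - \<gamma> * coeff p i"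
      by simp
    then have "\<bar>norm (coeff ([:1, -\<gamma>:] * p) (Suc i)) - norm (coeff p (Suc i))\<bar>
        \<le> norm (\<gamma> * coeff p i)"
      by (metis norm_minus_commute norm_triangle_ineq3 add_diff_cancel_left' diff_add_cancel)
    also have "\<dots> \<le> \<rho> * norm (coeff p i)"
      using assms(2) by (simp add: norm_mult mult_right_mono)
    finally have "\<bar>norm (coeff ([:1, -\<gamma>:] * p) (Suc i)) - norm (coeff p (Suc i))\<bar> * w ^ Suc i
        \<le> \<rho> * norm (coeff p i) * w ^ Suc i"
      using assms(1) by (intro mult_right_mono) auto
    moreover have "\<bar>norm (coeff ([:1, -\<gamma>:] * p) (Suc i)) - norm (coeff p (Suc i))\<bar> * w ^ Suc i =
        \<bar>norm (coeff ([:1, -\<gamma>:] * p) (Suc i)) * w ^ Suc i - norm (coeff p (Suc i)) * w ^ Suc i\<bar>"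
      using assms(1) by (simp only: left_diff_distrib[symmetric] abs_mult abs_of_nonneg zero_le_power)
    ultimately show ?thesis by (simp only: power_Suc mult_ac)
  qed
  \<comment> \<open>The right side is truncated one index earlier because of the shift. The constant
    coefficients of the two polynomials agree, which starts the induction.\<close>
  have *: "\<bar>wnorm w (Suc n) ([:1, -\<gamma>:] * p) - wnorm w (Suc n) p\<bar> \<le> \<rho> * w * wnorm w n p" for n
  proof (induction n)
    case 0
    show ?case by (simp add: wnorm_Suc)
  next
    case (Suc n)
    have "\<rho> * w * wnorm w (Suc n) p = \<rho> * w * wnorm w n p + \<rho> * w * (norm (coeff p n) * w ^ n)"
      by (simp only: wnorm_Suc distrib_left)
    then show ?case
      using Suc step[of n] wnorm_Suc[of w "Suc n" p] wnorm_Suc[of w "Suc n" "[:1, -\<gamma>:] * p"]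
      by linarith
  qed
  have "\<bar>wnorm w n ([:1, -\<gamma>:] * p) - wnorm w n p\<bar> \<le> \<rho> * w * wnorm w n p"
  proof (cases n)
    case (Suc n')
    have "\<rho> * w * wnorm w n' p \<le> \<rho> * w * wnorm w n p"
      using assms(1) \<rho> Suc by (intro mult_left_mono wnorm_mono) auto
    then show ?thesis using *[of n'] Suc by simp
  qed simp
  then have "wnorm w n p - \<rho> * w * wnorm w n p \<le> wnorm w n ([:1, -\<gamma>:] * p)"
    "wnorm w n ([:1, -\<gamma>:] * p) \<le> wnorm w n p + \<rho> * w * wnorm w n p" by linarith+
  then show "(1 - \<rho> * w) * wnorm w n p \<le> wnorm w n ([:1, -\<gamma>:] * p)"
    "wnorm w n ([:1, -\<gamma>:] * p) \<le> (1 + \<rho> * w) * wnorm w n p"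
    by (simp_all add: algebra_simps)
qed

lemma wnorm_prod_mult:
  fixes p :: "'a::real_normed_field poly"
  assumes "finite I" "0 \<le> w" "\<And>i. i \<in> I \<Longrightarrow> norm (\<gamma> i) \<le> \<rho>" "0 \<le> \<rho>" "\<rho> * w < 1"
  shows "(1 - \<rho> * w) ^ card I * wnorm w n p \<le> wnorm w n ((\<Prod>i\<in>I. [:1, -\<gamma> i:]) * p)"
    and "wnorm w n ((\<Prod>i\<in>I. [:1, -\<gamma> i:]) * p) \<le> (1 + \<rho> * w) ^ card I * wnorm w n p"
proof -
  have "(1 - \<rho> * w) ^ card I * wnorm w n p \<le> wnorm w n ((\<Prod>i\<in>I. [:1, -\<gamma> i:]) * p) \<and>
      wnorm w n ((\<Prod>i\<in>I. [:1, -\<gamma> i:]) * p) \<le> (1 + \<rho> * w) ^ card I * wnorm w n p"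
    using assms(1,3)
  proof (induction I)
    case (insert i I)
    let ?q = "(\<Prod>i\<in>I. [:1, -\<gamma> i:]) * p"
    have q: "(\<Prod>i\<in>insert i I. [:1, -\<gamma> i:]) * p = [:1, -\<gamma> i:] * ?q"
      by (simp only: prod.insert[OF insert.hyps] mult.assoc)
    have \<gamma>: "norm (\<gamma> i) \<le> \<rho>" using insert.prems by simp
    have IH: "(1 - \<rho> * w) ^ card I * wnorm w n p \<le> wnorm w n ?q"
      "wnorm w n ?q \<le> (1 + \<rho> * w) ^ card I * wnorm w n p"
      using insert.IH insert.prems by simp_all
    have "(1 - \<rho> * w) ^ card (insert i I) * wnorm w n p
        = (1 - \<rho> * w) * ((1 - \<rho> * w) ^ card I * wnorm w n p)"
      using insert.hyps by simp
    also have "\<dots> \<le> (1 - \<rho> * w) * wnorm w n ?q"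
      using IH(1) assms by (intro mult_left_mono) auto
    also have "\<dots> \<le> wnorm w n ([:1, -\<gamma> i:] * ?q)"
      by (rule wnorm_linear_mult(1)[OF assms(2) \<gamma>])
    finally have 1: "(1 - \<rho> * w) ^ card (insert i I) * wnorm w n p \<le> wnorm w n ([:1, -\<gamma> i:] * ?q)" .
    have "wnorm w n ([:1, -\<gamma> i:] * ?q) \<le> (1 + \<rho> * w) * wnorm w n ?q"
      by (rule wnorm_linear_mult(2)[OF assms(2) \<gamma>])
    also have "\<dots> \<le> (1 + \<rho> * w) * ((1 + \<rho> * w) ^ card I * wnorm w n p)"
      using IH(2) assms by (intro mult_left_mono) auto
    also have "\<dots> = (1 + \<rho> * w) ^ card (insert i I) * wnorm w n p"
      using insert.hyps by simp
    finally show ?case using 1 unfolding q by blast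
  qed simp
  then show "(1 - \<rho> * w) ^ card I * wnorm w n p \<le> wnorm w n ((\<Prod>i\<in>I. [:1, -\<gamma> i:]) * p)"
    "wnorm w n ((\<Prod>i\<in>I. [:1, -\<gamma> i:]) * p) \<le> (1 + \<rho> * w) ^ card I * wnorm w n p"
    by blast+
qed

text \<open>The part of \<open>F\<close> below the gap controls all of \<open>H\<close>: the gap
  lets the truncation of \<open>F\<close> at \<open>N\<close> be replaced by the one at
  \<open>k\<close>, and truncation at \<open>N\<close> loses nothing of \<open>H\<close> since its
  degree is less than \<open>N\<close>. Multiplying the factors back on then bounds every truncation
  of \<open>F\<close>.\<close>

lemma wnorm_le_below_gap:
  fixes H :: "'a::real_normed_field poly"
  assumes "finite I" "0 \<le> w" "\<And>i. i \<in> I \<Longrightarrow> norm (\<gamma> i) \<le> \<rho>" "0 \<le> \<rho>" "\<rho> * w < 1"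
    and F: "F = (\<Prod>i\<in>I. [:1, -\<gamma> i:]) * H"
    and deg: "degree H < N"
    and gap: "\<And>i. k \<le> i \<Longrightarrow> i < N \<Longrightarrow> coeff F i = 0"
  shows "wnorm w M F \<le> ((1 + \<rho> * w) / (1 - \<rho> * w)) ^ card I * wnorm w k F"
proof -
  have "wnorm w M F \<le> wnorm w (max M N) F"
    using assms(2) by (intro wnorm_mono) auto
  also have "\<dots> \<le> (1 + \<rho> * w) ^ card I * wnorm w (max M N) H"
    unfolding F by (intro wnorm_prod_mult(2)) (use assms in auto)
  also have "wnorm w (max M N) H = wnorm w N H"
    using deg by (intro wnorm_eqI) (auto simp: coeff_eq_0)
  also have "wnorm w N H \<le> wnorm w k F / (1 - \<rho> * w) ^ card I"
  proof -
    have "(1 - \<rho> * w) ^ card I * wnorm w N H \<le> wnorm w N F"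
      unfolding F by (intro wnorm_prod_mult(1)) (use assms in auto)
    also have "wnorm w N F \<le> wnorm w k F"
    proof (cases "k \<le> N")
      case True
      then show ?thesis using gap by (simp add: wnorm_eqI)
    next
      case False
      then show ?thesis using assms(2) by (intro wnorm_mono) auto
    qed
    finally show ?thesis using assms(5) by (simp add: field_simps)
  qed
  finally show ?thesis using assms by (simp add: power_divide mult_left_mono)
qed

text \<open>Reflection exchanges low and high coefficients, so a truncated norm of the reflection
  measures the top \<open>n\<close> coefficients of \<open>p\<close>, with the weight inverted. For
  \<open>n\<close> beyond the degree the natural subtraction yields 0 and all coefficients are
  counted.\<close>

lemma wnorm_reflect_poly:
  assumes "0 < w"
  shows "w ^ degree p * wnorm (1 / w) n (reflect_poly p)
    = (\<Sum>i\<in>{Suc (degree p) - n..degree p}. norm (coeff p i) * w ^ i)"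
proof -
  have "w ^ degree p * wnorm (1 / w) n (reflect_poly p) =
      (\<Sum>i<n. if i \<le> degree p then norm (coeff p (degree p - i)) * w ^ (degree p - i) else 0)"
    unfolding wnorm_def sum_distrib_left using assms
    by (intro sum.cong) (auto simp: coeff_reflect_poly power_diff power_one_over field_simps)
  also have "\<dots> = (\<Sum>i\<in>{i\<in>{..<n}. i \<le> degree p}. norm (coeff p (degree p - i)) * w ^ (degree p - i))"
    by (rule sum.inter_filter[symmetric]) simp
  also have "\<dots> = (\<Sum>i\<in>{Suc (degree p) - n..degree p}. norm (coeff p i) * w ^ i)"
    by (rule sum.reindex_bij_witness[where i = "\<lambda>i. degree p - i" and j = "\<lambda>i. degree p - i"]) auto
  finally show ?thesis .
qed

text \<open>Weight \<open>s < R\<close> suits the reciprocals of the large roots, and weight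
  \<open>1 / r\<close> with \<open>r > \<rho>\<close> suits the small roots after reflection.
  Switching between the weights \<open>r\<close> and \<open>s\<close> on the two sides of a gap of
  length \<open>m\<close> gains \<open>(r / s) ^ m\<close>, which \<open>contr\<close> makes
  stronger than the constants lost.\<close>

lemma gap_imp_eq_0:
  fixes \<alpha> :: "'i \<Rightarrow> 'a::real_normed_field"
  assumes fin: "finite I" "finite J"
    and \<rho>: "0 \<le> \<rho>" "\<rho> < r" "r < s" "s < R"
    and small: "\<And>i. i \<in> I \<Longrightarrow> norm (\<alpha> i) \<le> \<rho>"
    and large: "\<And>i. i \<in> J \<Longrightarrow> R \<le> norm (\<alpha> i)"
    and F: "F = (\<Prod>i\<in>I. [:-\<alpha> i, 1:]) * (\<Prod>i\<in>J. [:-\<alpha> i, 1:]) * Y"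
    and deg: "degree Y < m"
    and gap: "\<And>i. card I \<le> i \<Longrightarrow> i < card I + m \<Longrightarrow> coeff F i = 0"
    and contr: "((s + R) / (R - s)) ^ card J * ((r + \<rho>) / (r - \<rho>)) ^ card I * (r / s) ^ m < 1"
  shows "F = 0"
proof (rule ccontr)
  assume "F \<noteq> 0"
  define D where "D = degree F"
  define N where "N = card I + m"
  define C where "C = ((s + R) / (R - s)) ^ card J"
  define C' where "C' = ((r + \<rho>) / (r - \<rho>)) ^ card I"
  define u where "u = (\<Prod>i\<in>I. [:-\<alpha> i, 1:])"
  define v where "v = (\<Prod>i\<in>J. [:-\<alpha> i, 1:])"
  have C: "0 \<le> C" "0 \<le> C'" using \<rho> by (auto simp: C_def C'_def)
  have degu: "degree u = card I"
    unfolding u_def by (subst degree_prod_eq_sum_degree) auto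
  have "1 / norm (\<alpha> i) \<le> 1 / R" if "i \<in> J" for i
    using large[OF that] \<rho> by (intro divide_left_mono mult_pos_pos) auto
  \<comment> \<open>The large-root factors are rescaled to constant term 1, so that they involve
    only \<open>1 / \<alpha> i\<close>, of norm at most \<open>1 / R\<close>.\<close>
  moreover have F1: "F = (\<Prod>i\<in>J. [:1, - (1 / \<alpha> i):]) * Polynomial.smult (\<Prod>i\<in>J. -\<alpha> i) (u * Y)"
  proof -
    have "\<alpha> i \<noteq> 0" if "i \<in> J" for i using large[OF that] \<rho> by auto
    then have "v = (\<Prod>i\<in>J. Polynomial.smult (-\<alpha> i) [:1, - (1 / \<alpha> i):])"
      unfolding v_def by (intro prod.cong) auto
    then have v: "v = Polynomial.smult (\<Prod>i\<in>J. -\<alpha> i) (\<Prod>i\<in>J. [:1, - (1 / \<alpha> i):])"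
      by (simp only: prod_smult)
    show ?thesis unfolding F u_def[symmetric] v_def[symmetric] v by (simp add: mult_ac)
  qed
  moreover have "degree (Polynomial.smult (\<Prod>i\<in>J. -\<alpha> i) (u * Y)) < N"
    using degree_smult_le[of "\<Prod>i\<in>J. -\<alpha> i" "u * Y"] degree_mult_le[of u Y] deg degu
    unfolding N_def by linarith
  ultimately have "wnorm s (Suc D) F
      \<le> ((1 + 1 / R * s) / (1 - 1 / R * s)) ^ card J * wnorm s (card I) F"
    using \<rho> gap by (intro wnorm_le_below_gap[where N = N, OF fin(2) _ _ _ _ F1])
      (auto simp: N_def norm_divide)
  also have "(1 + 1 / R * s) / (1 - 1 / R * s) = (s + R) / (R - s)"
    using \<rho> by (simp add: field_simps)
  finally have high: "wnorm s (Suc D) F \<le> C * wnorm s (card I) F"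
    unfolding C_def .
  have Y: "Y \<noteq> 0" "v \<noteq> 0" using \<open>F \<noteq> 0\<close> unfolding F v_def by auto
  \<comment> \<open>Reflection gives the small-root factors constant term 1, now with the roots
    themselves as parameters.\<close>
  have F2: "reflect_poly F = (\<Prod>i\<in>I. [:1, -\<alpha> i:]) * reflect_poly (v * Y)"
  proof -
    have "reflect_poly [:-\<alpha> i, 1:] = [:1, -\<alpha> i:]" for i
      by (auto simp: reflect_poly_def cCons_def)
    then have "reflect_poly u = (\<Prod>i\<in>I. [:1, -\<alpha> i:])"
      unfolding u_def by (simp add: reflect_poly_prod)
    then show ?thesis
      unfolding F u_def[symmetric] v_def[symmetric] by (simp add: reflect_poly_mult mult.assoc)
  qed
  have D: "D = card I + degree (v * Y)"
    using Y degu \<open>F \<noteq> 0\<close> unfolding D_def F u_def[symmetric] v_def[symmetric] mult.assoc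
    by (subst degree_mult_eq) auto
  \<comment> \<open>Index \<open>i\<close> of the reflection is index \<open>D - i\<close> of
    \<open>F\<close>, so the gap from \<open>card I\<close> to \<open>N - 1\<close> becomes the one
    from \<open>Suc D - N\<close> to \<open>D - card I\<close>. If \<open>D < N\<close>, it starts
    at 0.\<close>
  have "wnorm (1 / r) (Suc D) (reflect_poly F)
      \<le> ((1 + \<rho> * (1 / r)) / (1 - \<rho> * (1 / r))) ^ card I * wnorm (1 / r) (Suc D - N) (reflect_poly F)"
  proof (rule wnorm_le_below_gap[where N = "Suc D - card I", OF fin(1) _ _ _ _ F2])
    show "degree (reflect_poly (v * Y)) < Suc D - card I"
      using degree_reflect_poly_le[of "v * Y"] D by linarith
    show "coeff (reflect_poly F) i = 0" if "Suc D - N \<le> i" "i < Suc D - card I" for i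
      using that gap[of "D - i"] by (auto simp: coeff_reflect_poly D_def N_def)
  qed (use \<rho> small in auto)
  then have "r ^ D * wnorm (1 / r) (Suc D) (reflect_poly F)
      \<le> r ^ D * (((1 + \<rho> * (1 / r)) / (1 - \<rho> * (1 / r))) ^ card I * wnorm (1 / r) (Suc D - N) (reflect_poly F))"
    using \<rho> by (intro mult_left_mono) auto
  also have "(1 + \<rho> * (1 / r)) / (1 - \<rho> * (1 / r)) = (r + \<rho>) / (r - \<rho>)"
    using \<rho> by (simp add: field_simps)
  finally have "r ^ D * wnorm (1 / r) (Suc D) (reflect_poly F)
      \<le> C' * (r ^ D * wnorm (1 / r) (Suc D - N) (reflect_poly F))"
    by (simp add: C'_def mult_ac)
  moreover have "r ^ D * wnorm (1 / r) (Suc D) (reflect_poly F) = wnorm r (Suc D) F"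
    using \<rho> unfolding D_def by (subst wnorm_reflect_poly) (auto simp: wnorm_def atLeast0AtMost lessThan_Suc_atMost[symmetric])
  moreover have "r ^ D * wnorm (1 / r) (Suc D - N) (reflect_poly F)
      \<le> (\<Sum>i\<in>{N..D}. norm (coeff F i) * r ^ i)"
    using \<rho> unfolding D_def by (subst wnorm_reflect_poly) (auto intro!: sum_mono2)
  ultimately have low: "wnorm r (Suc D) F \<le> C' * (\<Sum>i\<in>{N..D}. norm (coeff F i) * r ^ i)"
    using mult_left_mono[OF _ C(2)] by fastforce
  \<comment> \<open>All indices above the gap are at least \<open>N\<close>, so changing the weight
    from \<open>r\<close> to \<open>s\<close> gains \<open>(r / s) ^ N\<close>.\<close>
  have "(\<Sum>i\<in>{N..D}. norm (coeff F i) * r ^ i) \<le> (\<Sum>i\<in>{N..D}. (r / s) ^ N * (norm (coeff F i) * s ^ i))"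
  proof (rule sum_mono)
    fix i assume i: "i \<in> {N..D}"
    have "r ^ i = (r / s) ^ i * s ^ i" using \<rho> by (simp add: power_divide)
    also have "\<dots> \<le> (r / s) ^ N * s ^ i"
      using i \<rho> by (intro mult_right_mono power_decreasing) auto
    finally show "norm (coeff F i) * r ^ i \<le> (r / s) ^ N * (norm (coeff F i) * s ^ i)"
      by (metis mult.left_commute mult_left_mono norm_ge_zero)
  qed
  also have "\<dots> \<le> (r / s) ^ N * wnorm s (Suc D) F"
    unfolding wnorm_def sum_distrib_left[symmetric] using \<rho>
    by (intro mult_left_mono sum_mono2) auto
  also have "\<dots> \<le> (r / s) ^ N * (C * wnorm s (card I) F)"
    using high \<rho> by (intro mult_left_mono) auto
  also have "\<dots> = C * (r / s) ^ m * ((r / s) ^ card I * wnorm s (card I) F)"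
    by (simp add: N_def power_add)
  \<comment> \<open>Below the gap all indices are less than \<open>card I\<close>, so returning to
    weight \<open>r\<close> uses up only \<open>(r / s) ^ card I\<close> of the gain; the remaining
    power is \<open>m\<close>.\<close>
  also have "(r / s) ^ card I * wnorm s (card I) F \<le> wnorm r (card I) F"
    unfolding wnorm_def sum_distrib_left
  proof (rule sum_mono)
    fix i assume i: "i \<in> {..<card I}"
    have "(r / s) ^ card I * s ^ i \<le> (r / s) ^ i * s ^ i"
      using i \<rho> by (intro mult_right_mono power_decreasing) auto
    also have "\<dots> = r ^ i" using \<rho> by (simp add: power_divide)
    finally show "(r / s) ^ card I * (norm (coeff F i) * s ^ i) \<le> norm (coeff F i) * r ^ i"
      by (metis mult.left_commute mult_left_mono norm_ge_zero)
  qed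
  also have "wnorm r (card I) F \<le> wnorm r (Suc D) F"
    using \<rho> D by (intro wnorm_mono) auto
  finally have "(\<Sum>i\<in>{N..D}. norm (coeff F i) * r ^ i) \<le> C * (r / s) ^ m * wnorm r (Suc D) F"
    using C \<rho> by (simp add: mult_left_mono)
  with low C have "wnorm r (Suc D) F \<le> C' * (C * (r / s) ^ m * wnorm r (Suc D) F)"
    using mult_left_mono[OF _ C(2)] by fastforce
  then have "(1 - C * C' * (r / s) ^ m) * wnorm r (Suc D) F \<le> 0"
    by (simp add: algebra_simps)
  then have "wnorm r (Suc D) F \<le> 0"
    using contr by (simp add: mult_le_0_iff C_def C'_def)
  moreover have "0 < norm (coeff F D) * r ^ D"
    using \<open>F \<noteq> 0\<close> \<rho> by (simp add: D_def)
  ultimately show False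
    using wnorm_nonneg[of r D F] \<rho> by (simp add: wnorm_Suc)
qed

section \<open>Continuity of the ordered roots\<close>

text \<open>A Cauchy-type root bound: if \<open>norm z > 1\<close>, every lower term is at most its
  coefficient norm times \<open>norm z ^ (degree p - 1)\<close>, and these terms must balance the
  leading one.\<close>

lemma norm_root_le:
  fixes p :: "'a::real_normed_field poly"
  assumes "p \<noteq> 0" "poly p z = 0"
  shows "norm z \<le> 1 + (\<Sum>i<degree p. norm (coeff p i)) / norm (lead_coeff p)"
proof (cases "norm z \<le> 1")
  case True
  moreover have "0 \<le> (\<Sum>i<degree p. norm (coeff p i)) / norm (lead_coeff p)"
    by (intro divide_nonneg_nonneg sum_nonneg) auto
  ultimately show ?thesis by linarith
next
  case False
  then have z: "1 < norm z" by simp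
  have "degree p \<noteq> 0"
  proof
    assume "degree p = 0"
    then obtain a where "p = [:a:]" by (elim degree_eq_zeroE)
    with assms show False by simp
  qed
  then obtain d where d: "degree p = Suc d" by (cases "degree p") auto
  have "(\<Sum>i<degree p. coeff p i * z ^ i) + lead_coeff p * z ^ degree p = 0"
    using assms(2) by (simp add: poly_altdef lessThan_Suc_atMost[symmetric])
  then have "lead_coeff p * z ^ degree p = - (\<Sum>i<degree p. coeff p i * z ^ i)"
    unfolding add_eq_0_iff .
  from arg_cong[OF this, of norm]
  have "norm (lead_coeff p) * norm z ^ degree p = norm (\<Sum>i<degree p. coeff p i * z ^ i)"
    by (simp only: norm_minus_cancel norm_mult norm_power)
  also have "\<dots> \<le> (\<Sum>i<degree p. norm (coeff p i) * norm z ^ d)"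
  proof (rule sum_norm_le)
    fix i assume "i \<in> {..<degree p}"
    then show "norm (coeff p i * z ^ i) \<le> norm (coeff p i) * norm z ^ d"
      using z d by (auto simp: norm_mult norm_power intro!: mult_left_mono power_increasing)
  qed
  finally have "(norm (lead_coeff p) * norm z) * norm z ^ d \<le> (\<Sum>i<degree p. norm (coeff p i)) * norm z ^ d"
    by (simp only: d power_Suc sum_distrib_right mult.assoc)
  moreover have "0 < norm z ^ d" using z by (intro zero_less_power) linarith
  ultimately have "norm (lead_coeff p) * norm z \<le> (\<Sum>i<degree p. norm (coeff p i))"
    by (simp only: mult_le_cancel_right_pos)
  then have "norm z \<le> (\<Sum>i<degree p. norm (coeff p i)) / norm (lead_coeff p)"
    using assms(1) by (simp add: field_simps)
  then show ?thesis by linarith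
qed

text \<open>Bolzano-Weierstrass: a subsequence with monotone real parts is refined to one with
  monotone imaginary parts as well.\<close>

lemma bounded_complex_convergent_subseq:
  fixes f :: "nat \<Rightarrow> complex"
  assumes "\<And>n. cmod (f n) \<le> B"
  shows "\<exists>\<phi> z. strict_mono (\<phi> :: nat \<Rightarrow> nat) \<and> (\<lambda>n. f (\<phi> n)) \<longlonglongrightarrow> z"
proof -
  have bdd: "Bseq (\<lambda>n. Re (f (\<phi> n)))" "Bseq (\<lambda>n. Im (f (\<phi> n)))" for \<phi> :: "nat \<Rightarrow> nat"
    using assms abs_Re_le_cmod abs_Im_le_cmod
    by (intro BseqI'[where K = B]; metis order_trans real_norm_def)+
  obtain \<phi> :: "nat \<Rightarrow> nat" where \<phi>: "strict_mono \<phi>" "monoseq (\<lambda>n. Re (f (\<phi> n)))"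
    using seq_monosub[of "\<lambda>n. Re (f n)"] by blast
  obtain a where a: "(\<lambda>n. Re (f (\<phi> n))) \<longlonglongrightarrow> a"
    using Bseq_monoseq_convergent[OF bdd(1) \<phi>(2)] by (auto simp: convergent_def)
  obtain \<psi> :: "nat \<Rightarrow> nat" where \<psi>: "strict_mono \<psi>" "monoseq (\<lambda>n. Im (f (\<phi> (\<psi> n))))"
    using seq_monosub[of "\<lambda>n. Im (f (\<phi> n))"] by blast
  obtain b where b: "(\<lambda>n. Im (f (\<phi> (\<psi> n)))) \<longlonglongrightarrow> b"
    using Bseq_monoseq_convergent[OF bdd(2)[of "\<lambda>n. \<phi> (\<psi> n)"] \<psi>(2)] by (auto simp: convergent_def)
  have "(\<lambda>n. Re (f (\<phi> (\<psi> n)))) \<longlonglongrightarrow> a"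
    using LIMSEQ_subseq_LIMSEQ[OF a \<psi>(1)] by (simp add: o_def)
  then have "(\<lambda>n. f ((\<phi> \<circ> \<psi>) n)) \<longlonglongrightarrow> Complex a b"
    using b by (simp add: tendsto_complex_iff o_def)
  then show ?thesis using strict_mono_o[OF \<phi>(1) \<psi>(1)] by blast
qed

lemma finite_family_convergent_subseq:
  fixes f :: "nat \<Rightarrow> 'i \<Rightarrow> complex"
  assumes "finite I" "\<And>m i. i \<in> I \<Longrightarrow> cmod (f m i) \<le> B"
  shows "\<exists>\<phi> g. strict_mono (\<phi> :: nat \<Rightarrow> nat) \<and> (\<forall>i\<in>I. (\<lambda>m. f (\<phi> m) i) \<longlonglongrightarrow> g i)"
  using assms
proof (induction I)
  case empty
  have "strict_mono (id :: nat \<Rightarrow> nat)" by (simp add: strict_mono_def)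
  then show ?case by blast
next
  case (insert i I)
  then have "\<exists>\<phi> g. strict_mono (\<phi> :: nat \<Rightarrow> nat) \<and> (\<forall>i\<in>I. (\<lambda>m. f (\<phi> m) i) \<longlonglongrightarrow> g i)"
    by simp
  then obtain \<phi> :: "nat \<Rightarrow> nat" and g
    where \<phi>: "strict_mono \<phi>" "\<And>j. j \<in> I \<Longrightarrow> (\<lambda>m. f (\<phi> m) j) \<longlonglongrightarrow> g j" by blast
  have "\<And>m. cmod (f (\<phi> m) i) \<le> B" using insert.prems by simp
  from bounded_complex_convergent_subseq[of "\<lambda>m. f (\<phi> m) i", OF this] obtain \<psi> z
    where \<psi>: "strict_mono (\<psi> :: nat \<Rightarrow> nat)" and z: "(\<lambda>m. f (\<phi> (\<psi> m)) i) \<longlonglongrightarrow> z"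
    by blast
  have "(\<lambda>m. f ((\<phi> \<circ> \<psi>) m) j) \<longlonglongrightarrow> (g(i := z)) j" if "j \<in> insert i I" for j
    using that z LIMSEQ_subseq_LIMSEQ[OF \<phi>(2) \<psi>(1), of j] by (cases "j = i") (auto simp: o_def)
  then show ?case using strict_mono_o[OF \<phi>(1) \<psi>(1)] by blast
qed

lemma ordered_roots_prod:
  assumes "ordered_roots p \<alpha>"
  shows "p = Polynomial.smult (lead_coeff p) (\<Prod>i\<in>{1..degree p}. [:- \<alpha> i, 1:])"
proof -
  have "p = Polynomial.smult (lead_coeff p) (\<Prod>x\<in>#proots p. [:-x, 1:])"
    by (rule complex_poly_decompose_multiset[symmetric])
  also have "(\<Prod>x\<in>#proots p. [:-x, 1:]) = (\<Prod>i\<in>{1..degree p}. [:- \<alpha> i, 1:])"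
    using assms unfolding ordered_roots_def
    by (metis (no_types, lifting) image_mset.compositionality o_def prod_unfold_prod_mset
        image_mset_cong)
  finally show ?thesis .
qed

lemma ordered_roots_mono:
  assumes "ordered_roots p \<alpha>" "0 < i" "i \<le> j" "j \<le> degree p"
  shows "cmod (\<alpha> i) \<le> cmod (\<alpha> j)"
  using assms(3,4)
proof (induction j rule: dec_induct)
  case (step j)
  then have "cmod (\<alpha> j) \<le> cmod (\<alpha> (j + 1))"
    using assms(1,2) by (simp add: ordered_roots_def)
  with step show ?case by simp
qed simp

lemma proots_prod_linear:
  fixes \<gamma> :: "'i \<Rightarrow> 'a::idom"
  assumes "finite I"
  shows "proots (\<Prod>i\<in>I. [:-\<gamma> i, 1:]) = image_mset \<gamma> (mset_set I)"
  using assms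
proof (induction I)
  case (insert i I)
  have "(\<Prod>i\<in>I. [:-\<gamma> i, 1:]) \<noteq> 0" using insert by simp
  then have "proots (\<Prod>i\<in>insert i I. [:-\<gamma> i, 1:]) = proots [:-\<gamma> i, 1:] + proots (\<Prod>i\<in>I. [:-\<gamma> i, 1:])"
    by (subst prod.insert[OF insert.hyps], subst proots_mult) auto
  then show ?case using insert by simp
qed simp

text \<open>By compactness the roots converge along a subsequence to some \<open>\<gamma>\<close>,
  and the limit of the factorizations shows that \<open>\<gamma>\<close> is an ordering of the roots
  of \<open>p\<close>. It may differ from \<open>\<alpha>\<close>, but the moduli of ordered roots
  are unique.\<close>

lemma ordered_roots_convergent_subseq:
  fixes P :: "nat \<Rightarrow> complex poly"
  assumes "p \<noteq> 0" and deg: "\<And>m. degree (P m) = degree p"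
    and conv: "\<And>i. (\<lambda>m. coeff (P m) i) \<longlonglongrightarrow> coeff p i"
    and \<alpha>: "ordered_roots p \<alpha>" and \<beta>: "\<And>m. ordered_roots (P m) (\<beta> m)"
  shows "\<exists>\<phi>. strict_mono (\<phi> :: nat \<Rightarrow> nat) \<and>
    (\<forall>i\<in>{1..degree p}. (\<lambda>m. cmod (\<beta> (\<phi> m) i)) \<longlonglongrightarrow> cmod (\<alpha> i))"
proof -
  define d where "d = degree p"
  \<comment> \<open>The Cauchy-type bounds for the \<open>P m\<close> converge, because the leading
    coefficients have a nonzero limit; hence one \<open>B\<close> bounds all roots.\<close>
  have "(\<lambda>m. 1 + (\<Sum>i<d. norm (coeff (P m) i)) / norm (coeff (P m) d))
      \<longlonglongrightarrow> 1 + (\<Sum>i<d. norm (coeff p i)) / norm (coeff p d)"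
    using assms(1) by (intro tendsto_intros conv) (auto simp: d_def)
  then have "Bseq (\<lambda>m. 1 + (\<Sum>i<d. norm (coeff (P m) i)) / norm (coeff (P m) d))"
    by (intro convergent_imp_Bseq convergentI)
  then obtain B where B: "\<forall>m. norm (1 + (\<Sum>i<d. norm (coeff (P m) i)) / norm (coeff (P m) d)) \<le> B"
    by (rule BseqE)
  have "cmod (\<beta> m i) \<le> B" if "i \<in> {1..d}" for m i
  proof -
    have "\<beta> m i \<in># image_mset (\<beta> m) (mset_set {1..degree (P m)})"
      using that deg by (simp add: d_def)
    then have "\<beta> m i \<in># proots (P m)"
      using \<beta>[of m] unfolding ordered_roots_def by metis
    moreover have "P m \<noteq> 0" using that deg[of m] by (auto simp: d_def)
    ultimately have "cmod (\<beta> m i) \<le> 1 + (\<Sum>i<d. norm (coeff (P m) i)) / norm (coeff (P m) d)"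
      using norm_root_le[of "P m" "\<beta> m i"] deg[of m] by (simp add: d_def)
    then show ?thesis using B[rule_format, of m] unfolding real_norm_def by linarith
  qed
  from finite_family_convergent_subseq[of "{1..d}" \<beta>, OF _ this]
  obtain \<phi> :: "nat \<Rightarrow> nat" and \<gamma>
    where \<phi>: "strict_mono \<phi>" and \<gamma>: "\<And>i. i \<in> {1..d} \<Longrightarrow> (\<lambda>m. \<beta> (\<phi> m) i) \<longlonglongrightarrow> \<gamma> i"
    by blast
  have conv': "(\<lambda>m. coeff (P (\<phi> m)) i) \<longlonglongrightarrow> coeff p i" for i
    using LIMSEQ_subseq_LIMSEQ[OF conv \<phi>] by (simp add: o_def)
  \<comment> \<open>Both sides are limits of the values at \<open>t\<close> of the
    \<open>P (\<phi> m)\<close>, once in expanded and once in factored form.\<close>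
  have "poly p t = poly (Polynomial.smult (lead_coeff p) (\<Prod>i\<in>{1..d}. [:- \<gamma> i, 1:])) t" for t
  proof (rule LIMSEQ_unique)
    have "(\<lambda>m. \<Sum>i\<le>d. coeff (P (\<phi> m)) i * t ^ i) \<longlonglongrightarrow> (\<Sum>i\<le>d. coeff p i * t ^ i)"
      by (intro tendsto_intros conv')
    then show "(\<lambda>m. poly (P (\<phi> m)) t) \<longlonglongrightarrow> poly p t"
      by (simp add: poly_altdef deg d_def)
    have "poly (P (\<phi> m)) t = coeff (P (\<phi> m)) d * (\<Prod>i\<in>{1..d}. t - \<beta> (\<phi> m) i)" for m
      by (subst ordered_roots_prod[OF \<beta>]) (simp add: poly_prod deg d_def)
    moreover have "(\<lambda>m. coeff (P (\<phi> m)) d * (\<Prod>i\<in>{1..d}. t - \<beta> (\<phi> m) i))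
        \<longlonglongrightarrow> coeff p d * (\<Prod>i\<in>{1..d}. t - \<gamma> i)"
      by (intro tendsto_intros conv' \<gamma>)
    ultimately show "(\<lambda>m. poly (P (\<phi> m)) t)
        \<longlonglongrightarrow> poly (Polynomial.smult (lead_coeff p) (\<Prod>i\<in>{1..d}. [:- \<gamma> i, 1:])) t"
      by (simp add: poly_prod d_def)
  qed
  then have "p = Polynomial.smult (lead_coeff p) (\<Prod>i\<in>{1..d}. [:- \<gamma> i, 1:])"
    by (simp add: poly_eq_poly_eq_iff[symmetric] fun_eq_iff)
  then have "proots p = image_mset \<gamma> (mset_set {1..d})"
    using \<open>p \<noteq> 0\<close> proots_prod_linear[of "{1..d}" \<gamma>]
    by (metis proots_smult finite_atLeastAtMost leading_coeff_0_iff)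
  moreover have "cmod (\<gamma> i) \<le> cmod (\<gamma> (i + 1))" if "0 < i" "i < d" for i
  proof (rule LIMSEQ_le)
    show "(\<lambda>m. cmod (\<beta> (\<phi> m) i)) \<longlonglongrightarrow> cmod (\<gamma> i)"
      "(\<lambda>m. cmod (\<beta> (\<phi> m) (i + 1))) \<longlonglongrightarrow> cmod (\<gamma> (i + 1))"
      using that by (intro tendsto_norm \<gamma>; simp)+
    show "\<exists>N. \<forall>m\<ge>N. cmod (\<beta> (\<phi> m) i) \<le> cmod (\<beta> (\<phi> m) (i + 1))"
      using \<beta> that deg by (auto simp: ordered_roots_def d_def)
  qed
  ultimately have "ordered_roots p \<gamma>" by (simp add: ordered_roots_def d_def)
  then have "cmod (\<gamma> i) = cmod (\<alpha> i)" if "i \<in> {1..d}" for i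
    using ordered_roots_cmod_unique[OF _ \<alpha>] that by (simp add: d_def)
  then have "\<forall>i\<in>{1..d}. (\<lambda>m. cmod (\<beta> (\<phi> m) i)) \<longlonglongrightarrow> cmod (\<alpha> i)"
    using \<gamma> by (metis tendsto_norm)
  then show ?thesis using \<phi> unfolding d_def by blast
qed

section \<open>The left kernel of a banded Toeplitz matrix\<close>

lemma coeff_symbol_poly:
  assumes "\<And>i. i < - int k \<Longrightarrow> c i = 0" "\<And>i. i > int h \<Longrightarrow> c i = 0"
  shows "coeff (symbol_poly k h n c x) l
    = c (int l - int k) - (if k \<le> l \<and> l \<le> k + n then x $ (l - k) else 0)"
proof -
  have "(\<Sum>j\<in>{- int k..int h}. if nat (int k + j) = l then c j else 0)
      = (\<Sum>j\<in>{- int k..int h}. if j = int l - int k then c j else 0)"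
    by (intro sum.cong) auto
  also have "\<dots> = c (int l - int k)"
    using assms by (auto simp: sum.delta)
  finally have 1: "(\<Sum>j\<in>{- int k..int h}. if nat (int k + j) = l then c j else 0) = c (int l - int k)" .
  have "(\<Sum>j\<le>n. if k + j = l then x $ j else 0)
      = (\<Sum>j\<le>n. if j = l - k then (if k \<le> l then x $ j else 0) else 0)"
    by (intro sum.cong) auto
  also have "\<dots> = (if k \<le> l \<and> l \<le> k + n then x $ (l - k) else 0)"
    by (auto simp: sum.delta)
  finally show ?thesis
    using 1 by (simp add: symbol_poly_def coeff_sum coeff_monom)
qed

text \<open>Rank below \<open>m\<close> makes every minor of order \<open>m\<close> vanish, in
  particular the one on the columns from \<open>j - k\<close> on. Its entry at \<open>(a, b)\<close>
  is the coefficient of the symbol polynomial at \<open>j + b - a\<close>, so applying a left kernel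
  vector to column \<open>b\<close> is a convolution: it computes the product coefficient at
  \<open>j + b\<close>.\<close>

lemma eigenvalue_locus_toeplitz_gap:
  assumes "0 < m" "k \<le> j" "j \<le> k + n"
    and c: "\<And>i. i < - int k \<Longrightarrow> c i = 0" "\<And>i. i > int h \<Longrightarrow> c i = 0"
    and x: "x \<in> eigenvalue_locus m n (leading_submatrix m n (toeplitz c))"
  shows "\<exists>Y. Y \<noteq> 0 \<and> degree Y < m \<and>
    (\<forall>i. j \<le> i \<and> i < j + m \<longrightarrow> coeff (symbol_poly k h n c x * Y) i = 0)"
proof -
  define Q where "Q = symbol_poly k h n c x"
  define M where "M = leading_submatrix m n (toeplitz c) - shift_combination m n x"
  define l where "l = j - k"
  define J where "J = {l..<l + m}"
  define B where "B = submatrix M UNIV J"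
  have coeffQ: "coeff Q i = c (int i - int k) - (if k \<le> i \<and> i \<le> k + n then x $ (i - k) else 0)" for i
    unfolding Q_def using c by (rule coeff_symbol_poly)
  have l: "l \<le> n" "j = k + l" using assms by (auto simp: l_def)
  have M: "M \<in> carrier_mat m (m + n)"
    by (auto simp: M_def leading_submatrix_def shift_combination_def)
  \<comment> \<open>Here \<open>j \<le> k + n\<close> is used: the \<open>m\<close> chosen columns
    fit among the \<open>m + n\<close> available ones.\<close>
  have cols: "{b. b < m + n \<and> b \<in> J} = J" using l by (auto simp: J_def)
  have cards: "card {i. i < dim_row M \<and> i \<in> UNIV} = m" "card {b. b < dim_col M \<and> b \<in> J} = m"
    using M cols by (simp_all add: J_def)
  have B: "B \<in> carrier_mat m m"
    using cards unfolding B_def by (metis dim_submatrix carrier_matI)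
  have pick: "pick J b = l + b" if "b < m" for b
  proof -
    have "{a \<in> J. a < l + b} = {l..<l + b}" using that by (auto simp: J_def)
    then show ?thesis using pick_card_in_set[of "l + b" J] that by (simp add: J_def)
  qed
  \<comment> \<open>For \<open>a > j + b\<close> the entry lies below the band and is zero. The case
    is separate because natural subtraction would return the coefficient at 0.\<close>
  have Bab: "B $$ (a, b) = (if a \<le> j + b then coeff Q (j + b - a) else 0)" if "a < m" "b < m" for a b
  proof -
    have "(\<Sum>s\<le>n. x $ s * shifted_identity m n s $$ (a, l + b))
        = (\<Sum>s\<le>n. if s = l + b - a then (if a \<le> l + b then x $ s else 0) else 0)"
      using that l by (intro sum.cong) (auto simp: shifted_identity_def)
    also have "\<dots> = (if a \<le> l + b \<and> l + b \<le> a + n then x $ (l + b - a) else 0)"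
      by (auto simp: sum.delta)
    finally have "B $$ (a, b) = c (int l + int b - int a)
        - (if a \<le> l + b \<and> l + b \<le> a + n then x $ (l + b - a) else 0)"
      using that l cards pick M
      by (simp add: B_def submatrix_index pick_UNIV)
        (simp add: M_def leading_submatrix_def shift_combination_def toeplitz_def algebra_simps)
    moreover have "c (int l + int b - int a) = 0" if "j + b < a"
      using that l by (intro c(1)) linarith
    moreover have "coeff Q (j + b - a) = c (int l + int b - int a)
        - (if a \<le> l + b \<and> l + b \<le> a + n then x $ (l + b - a) else 0)" if "a \<le> j + b"
    proof -
      have "int (j + b - a) - int k = int l + int b - int a" "j + b - a - k = l + b - a"
        "k \<le> j + b - a \<longleftrightarrow> a \<le> l + b" "j + b - a \<le> k + n \<longleftrightarrow> l + b \<le> a + n"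
        using that l assms(1) by linarith+
      then show ?thesis by (simp only: coeffQ)
    qed
    ultimately show ?thesis
      using l by (cases "a \<le> j + b") auto
  qed
  have "vec_space.rank m M < m"
    using x by (simp add: eigenvalue_locus_def M_def)
  then have "det B = 0"
    using vec_space.rank_gt_minor[OF M, of UNIV J] cols by (force simp: B_def J_def)
  then have "det (transpose_mat B) = 0" using det_transpose[OF B] by simp
  then obtain y where y: "y \<in> carrier_vec m" "y \<noteq> 0\<^sub>v m" "transpose_mat B *\<^sub>v y = 0\<^sub>v m"
    using det_0_iff_vec_prod_zero[of "transpose_mat B" m] B by auto
  define Y where "Y = (\<Sum>a<m. monom (y $ a) a)"
  have coeffY: "coeff Y a = (if a < m then y $ a else 0)" for a
    by (auto simp: Y_def coeff_sum coeff_monom sum.delta)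
  have "Y \<noteq> 0"
  proof
    assume "Y = 0"
    then have "y $ a = 0" if "a < m" for a using coeffY[of a] that by simp
    then show False using y by (auto simp: vec_eq_iff)
  qed
  moreover have "degree Y < m"
    using assms(1) coeffY by (metis \<open>Y \<noteq> 0\<close> leading_coeff_0_iff)
  moreover have "coeff (Q * Y) i = 0" if "j \<le> i" "i < j + m" for i
  proof -
    obtain b where b: "i = j + b" "b < m" using \<open>j \<le> i\<close> \<open>i < j + m\<close> le_Suc_ex by force
    have "coeff (Q * Y) i = (\<Sum>a\<le>j + b. coeff Y a * coeff Q (j + b - a))"
      by (simp add: mult.commute[of Q] coeff_mult b)
    also have "\<dots> = (\<Sum>a\<in>{a. a < m \<and> a \<le> j + b}. coeff Y a * coeff Q (j + b - a))"
      by (rule sum.mono_neutral_right) (auto simp: coeffY)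
    \<comment> \<open>The added terms with \<open>a > j + b\<close> vanish by
      \<open>Bab\<close>.\<close>
    also have "\<dots> = (\<Sum>a<m. B $$ (a, b) * y $ a)"
      by (rule sum.mono_neutral_cong_left) (auto simp: coeffY Bab b)
    also have "\<dots> = (transpose_mat B *\<^sub>v y) $ b"
      using B y(1) b by (auto simp: scalar_prod_def lessThan_atLeast0 intro!: sum.cong)
    finally show ?thesis using y b by simp
  qed
  ultimately show ?thesis unfolding Q_def by blast
qed

section \<open>A gap between limiting root moduli contradicts membership in the loci\<close>

theorem theorem12:
  fixes k h n :: nat and c :: "int \<Rightarrow> complex"
  assumes "k \<ge> 1" and "h \<ge> 1" and "n < h"
    and "c (int h) \<noteq> 0"
    and "\<And>i. i < - int k \<Longrightarrow> c i = 0"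
    and "\<And>i. i > int h \<Longrightarrow> c i = 0"
  shows "limit_set n (toeplitz c) \<subseteq> equimodular_set k h n c"
proof
  fix x assume "x \<in> limit_set n (toeplitz c)"
  then obtain X where x: "x \<in> carrier_vec (n + 1)" and X: "vec_tendsto (n + 1) X x"
    "\<And>m. 0 < m \<Longrightarrow> X m \<in> eigenvalue_locus m n (leading_submatrix m n (toeplitz c))"
    unfolding limit_set_def by blast
  define Q where "Q = symbol_poly k h n c"
  \<comment> \<open>Since \<open>n < h\<close>, the variables never reach the leading coefficient
    \<open>c (int h)\<close>; the degree is therefore constant along the sequence.\<close>
  have degQ: "degree (Q z) = k + h" for z
    unfolding Q_def using assms by (intro degree_symbol_poly) auto
  have Q0: "Q z \<noteq> 0" for z using degQ[of z] assms by auto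
  obtain \<alpha> where \<alpha>: "ordered_roots (Q x) \<alpha>" using ordered_roots_exists by blast
  have "\<forall>m. \<exists>\<beta>. ordered_roots (Q (X m)) \<beta>" using ordered_roots_exists by blast
  then obtain \<beta> where \<beta>: "\<And>m. ordered_roots (Q (X m)) (\<beta> m)" by metis
  have coeffQ: "coeff (Q z) i = c (int i - int k) - (if k \<le> i \<and> i \<le> k + n then z $ (i - k) else 0)" for z i
    unfolding Q_def using assms(5,6) by (rule coeff_symbol_poly)
  have "(\<lambda>m. coeff (Q (X m)) i) \<longlonglongrightarrow> coeff (Q x) i" for i
  proof -
    have "(\<lambda>m. X m $ (i - k)) \<longlonglongrightarrow> x $ (i - k)" if "k \<le> i \<and> i \<le> k + n"
      using X(1) that unfolding vec_tendsto_def by auto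
    then have "(\<lambda>m. if k \<le> i \<and> i \<le> k + n then X m $ (i - k) else 0)
        \<longlonglongrightarrow> (if k \<le> i \<and> i \<le> k + n then x $ (i - k) else 0)"
      by (cases "k \<le> i \<and> i \<le> k + n") (simp_all only: if_True if_False tendsto_const simp_thms)
    then show ?thesis
      unfolding coeffQ by (intro tendsto_diff tendsto_const)
  qed
  from ordered_roots_convergent_subseq[OF Q0 _ this \<alpha> \<beta>] obtain \<phi> :: "nat \<Rightarrow> nat"
    where \<phi>: "strict_mono \<phi>"
      and lim: "\<And>i. i \<in> {1..k + h} \<Longrightarrow> (\<lambda>m. cmod (\<beta> (\<phi> m) i)) \<longlonglongrightarrow> cmod (\<alpha> i)"
    by (auto simp: degQ)
  have "cmod (\<alpha> j) = cmod (\<alpha> (j + 1))" if j: "j \<in> {k..k + n}" for j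
  proof (rule ccontr)
    assume neq: "cmod (\<alpha> j) \<noteq> cmod (\<alpha> (j + 1))"
    have jd: "1 \<le> j" "j < k + h" using j assms by auto
    \<comment> \<open>Four steps of length \<open>\<delta>\<close> up from
      \<open>cmod (\<alpha> j)\<close> give \<open>\<rho>\<close>, \<open>r\<close>,
      \<open>s\<close>, \<open>R\<close>; the fifth keeps \<open>R\<close> strictly below
      \<open>cmod (\<alpha> (j + 1))\<close>.\<close>
    define \<delta> where "\<delta> = (cmod (\<alpha> (j + 1)) - cmod (\<alpha> j)) / 5"
    have \<delta>: "0 < \<delta>"
      using neq ordered_roots_mono[OF \<alpha>, of j "j + 1"] jd by (simp add: \<delta>_def degQ)
    define \<rho> r s R where "\<rho> = cmod (\<alpha> j) + \<delta>" "r = \<rho> + \<delta>" "s = r + \<delta>" "R = s + \<delta>"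
    note radii = \<rho>_r_s_R_def
    have ord: "0 \<le> \<rho>" "\<rho> < r" "r < s" "s < R" "cmod (\<alpha> j) < \<rho>" "R < cmod (\<alpha> (j + 1))"
      using \<delta> by (simp_all add: radii) (simp add: \<delta>_def field_simps)
    have "\<forall>\<^sub>F m in sequentially. \<forall>i\<in>{1..j}. cmod (\<beta> (\<phi> m) i) < \<rho>"
    proof (intro eventually_ball_finite ballI)
      fix i assume i: "i \<in> {1..j}"
      then have "cmod (\<alpha> i) < \<rho>"
        using ordered_roots_mono[OF \<alpha>, of i j] jd ord by (simp add: degQ)
      then show "\<forall>\<^sub>F m in sequentially. cmod (\<beta> (\<phi> m) i) < \<rho>"
        using lim[of i] i jd by (auto intro: order_tendstoD(2))
    qed simp
    moreover have "\<forall>\<^sub>F m in sequentially. \<forall>i\<in>{j + 1..k + h}. R < cmod (\<beta> (\<phi> m) i)"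
    proof (intro eventually_ball_finite ballI)
      fix i assume i: "i \<in> {j + 1..k + h}"
      then have "R < cmod (\<alpha> i)"
        using ordered_roots_mono[OF \<alpha>, of "j + 1" i] jd ord by (simp add: degQ)
      then show "\<forall>\<^sub>F m in sequentially. R < cmod (\<beta> (\<phi> m) i)"
        using lim[of i] i jd by (auto intro: order_tendstoD(1))
    qed simp
    \<comment> \<open>The constant depends only on the radii, \<open>j\<close>, \<open>k\<close> and
      \<open>h\<close>, so the decay of \<open>(r / s) ^ \<phi> m\<close> eventually beats
      it.\<close>
    moreover define C where "C = ((s + R) / (R - s)) ^ (k + h - j) * ((r + \<rho>) / (r - \<rho>)) ^ j"
    have "(\<lambda>m. C * (r / s) ^ m) \<longlonglongrightarrow> C * 0"
      using ord by (intro tendsto_intros LIMSEQ_power_zero) simp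
    then have "(\<lambda>m. C * (r / s) ^ \<phi> m) \<longlonglongrightarrow> 0"
      using LIMSEQ_subseq_LIMSEQ[OF _ \<phi>] by (fastforce simp: o_def)
    then have "\<forall>\<^sub>F m in sequentially. C * (r / s) ^ \<phi> m < 1"
      by (rule order_tendstoD) simp
    ultimately have "\<forall>\<^sub>F m in sequentially. 0 < m \<and> (\<forall>i\<in>{1..j}. cmod (\<beta> (\<phi> m) i) < \<rho>) \<and>
        (\<forall>i\<in>{j + 1..k + h}. R < cmod (\<beta> (\<phi> m) i)) \<and> C * (r / s) ^ \<phi> m < 1"
      using eventually_gt_at_top[of 0] by eventually_elim simp
    then obtain m0 where m0: "0 < m0" "\<And>i. i \<in> {1..j} \<Longrightarrow> cmod (\<beta> (\<phi> m0) i) < \<rho>"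
      "\<And>i. i \<in> {j + 1..k + h} \<Longrightarrow> R < cmod (\<beta> (\<phi> m0) i)" "C * (r / s) ^ \<phi> m0 < 1"
      using eventually_happens'[OF sequentially_bot] by blast
    define m where "m = \<phi> m0"
    \<comment> \<open>Membership of \<open>X m\<close> in its locus is known only for positive
      \<open>m\<close>; here \<open>\<phi> m0 \<ge> m0\<close>.\<close>
    have m: "0 < m" using m0(1) seq_suble[OF \<phi>, of m0] by (simp add: m_def)
    have "\<exists>Y. Y \<noteq> 0 \<and> degree Y < m \<and>
        (\<forall>i. j \<le> i \<and> i < j + m \<longrightarrow> coeff (symbol_poly k h n c (X m) * Y) i = 0)"
      by (rule eigenvalue_locus_toeplitz_gap[OF m]) (use j assms(5,6) X(2)[OF m] in auto)
    then obtain Y where Y: "Y \<noteq> 0" "degree Y < m"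
      "\<And>i. j \<le> i \<Longrightarrow> i < j + m \<Longrightarrow> coeff (Q (X m) * Y) i = 0"
      unfolding Q_def by blast
    have "Q (X m) = Polynomial.smult (lead_coeff (Q (X m))) (\<Prod>i\<in>{1..k + h}. [:- \<beta> m i, 1:])"
      using ordered_roots_prod[OF \<beta>[of m]] by (simp add: degQ)
    also have "{1..k + h} = {1..j} \<union> {j + 1..k + h}" using jd by auto
    also have "(\<Prod>i\<in>{1..j} \<union> {j + 1..k + h}. [:- \<beta> m i, 1:])
        = (\<Prod>i\<in>{1..j}. [:- \<beta> m i, 1:]) * (\<Prod>i\<in>{j + 1..k + h}. [:- \<beta> m i, 1:])"
      by (rule prod.union_disjoint) auto
    \<comment> \<open>The leading coefficient is moved onto \<open>Y\<close>, which leaves the monic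
      factors that \<open>gap_imp_eq_0\<close> expects; \<open>card {1..j} = j\<close> matches the
      start of the gap.\<close>
    finally have "Q (X m) * Y = (\<Prod>i\<in>{1..j}. [:- \<beta> m i, 1:]) * (\<Prod>i\<in>{j + 1..k + h}. [:- \<beta> m i, 1:])
        * Polynomial.smult (lead_coeff (Q (X m))) Y"
      by (metis mult_smult_left mult_smult_right)
    then have "Q (X m) * Y = 0"
    proof (rule gap_imp_eq_0[rotated 8])
      show "degree (Polynomial.smult (lead_coeff (Q (X m))) Y) < m"
        using Y(2) degree_smult_le[of "lead_coeff (Q (X m))" Y] by linarith
      show "((s + R) / (R - s)) ^ card {j + 1..k + h} * ((r + \<rho>) / (r - \<rho>)) ^ card {1..j} * (r / s) ^ m < 1"
        using m0(4) by (simp add: C_def m_def)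
    qed (use ord m0 Y(3) in \<open>auto simp: m_def intro: less_imp_le\<close>)
    then show False using Y(1) Q0 by simp
  qed
  then show "x \<in> equimodular_set k h n c"
    using x \<alpha> unfolding equimodular_set_def Q_def by blast
qed

end
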